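(* For every $\varphi\in\mathsf{Form}_\Box$: if $\mathcal{BM}+\mathsf{BEM}\models\varphi$, then $\mathsf{iK}+\mathsf{bem}\vdash\varphi$.
   Context: The modal language $\mathsf{Form}_\Box$ is generated by $\top$, $\bot$, propositional variables $p\in\mathsf{Prop}$, $\wedge,\vee,\to$ and $\Box$; $\neg\varphi$ abbreviates $\varphi\to\bot$. The logic $\mathsf{iK}+\mathsf{bem}$ is the least set of formulas of $\mathsf{Form}_\Box$ containing all instances (with $A,B,C\in\mathsf{Form}_\Box$) of the intuitionistic axiom schemes $A\to(B\to A)$; $(A\to B)\to((A\to(B\to C))\to(A\to C))$; $A\to(A\vee B)$; $B\to(A\vee B)$; $(A\vee B)\to((A\to C)\to((B\to C)\to C))$; $A\to(B\to(A\wedge B))$; $(A\wedge B)\to A$; $(A\wedge B)\to B$; $\bot\to A$, all instances of $\Box(\varphi\to\psi)\to(\Box\varphi\to\Box\psi)$, and all instances of $\Box\varphi\vee\neg\Box\varphi$, and closed under modus ponens (from $\varphi$ and $\varphi\to\psi$ infer $\psi$) and necessitation (from $\varphi$ infer $\Box\varphi$). A birelational model is $\langle W,\leq,R,V\rangle$ with $W\ne\emptyset$, $\leq$ a partial order, $R\subseteq W\times W$ such that $x\leq y$ and $yRz$ imply $xRz$, and $V:W\to\mathcal P(\mathsf{Prop})$ monotone in $\leq$. Forcing: $x\Vdash p$ iff $p\in V(x)$; $x\nVdash\bot$; $\wedge,\vee$ pointwise; $x\Vdash\varphi\to\psi$ iff for all $y\geq x$, $y\Vdash\varphi$ implies $y\Vdash\psi$;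 $x\Vdash\Box\varphi$ iff $y\Vdash\varphi$ for all $y$ with $xRy$. The condition $\mathsf{BEM}$ is: for all $x,y,z$, $x\leq y$ and $xRz$ imply $yRz$. $\mathcal{BM}+\mathsf{BEM}\models\varphi$ means $\varphi$ is forced at every world of every birelational model satisfying $\mathsf{BEM}$.
   Formalization: ⊤ is read as the abbreviation ⊥→⊥ rather than as a primitive: the stated axioms and forcing clauses say nothing about ⊤, so as a primitive constant true everywhere it would be valid but not derivable. *)

theory Defs
  imports Main
begin

datatype 'p fm =
    Var 'p
  | Bot                   ("\<^bold>\<bottom>")
  | And "'p fm" "'p fm"   (infixr "\<^bold>\<and>" 65)
  | Or "'p fm" "'p fm"    (infixr "\<^bold>\<or>" 60)
  | Imp "'p fm" "'p fm"   (infixr "\<^bold>\<rightarrow>" 55)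
  | Box "'p fm"           ("\<^bold>\<box> _" [75] 75)

abbreviation Neg :: "'p fm \<Rightarrow> 'p fm" ("\<^bold>\<not> _" [75] 75) where
  "\<^bold>\<not> \<phi> \<equiv> \<phi> \<^bold>\<rightarrow> \<^bold>\<bottom>"

text \<open>
  Truth is the usual abbreviation rather than a constructor: the axiom schemes and the
  forcing clauses below have no case for it, and a primitive constant governed by no axiom
  would be valid but not derivable. Read this way it is an instance of an intuitionistic
  theorem scheme and is forced at every world.
\<close>
abbreviation Top :: "'p fm" ("\<^bold>\<top>") where
  "\<^bold>\<top> \<equiv> \<^bold>\<bottom> \<^bold>\<rightarrow> \<^bold>\<bottom>"

inductive iK_bem :: "'p fm \<Rightarrow> bool" ("iK+bem \<turnstile> _" [50] 50) where
  A1: "iK+bem \<turnstile> A \<^bold>\<rightarrow> (B \<^bold>\<rightarrow> A)"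
| A2: "iK+bem \<turnstile> (A \<^bold>\<rightarrow> B) \<^bold>\<rightarrow> ((A \<^bold>\<rightarrow> (B \<^bold>\<rightarrow> C)) \<^bold>\<rightarrow> (A \<^bold>\<rightarrow> C))"
| A3: "iK+bem \<turnstile> A \<^bold>\<rightarrow> (A \<^bold>\<or> B)"
| A4: "iK+bem \<turnstile> B \<^bold>\<rightarrow> (A \<^bold>\<or> B)"
| A5: "iK+bem \<turnstile> (A \<^bold>\<or> B) \<^bold>\<rightarrow> ((A \<^bold>\<rightarrow> C) \<^bold>\<rightarrow> ((B \<^bold>\<rightarrow> C) \<^bold>\<rightarrow> C))"
| A6: "iK+bem \<turnstile> A \<^bold>\<rightarrow> (B \<^bold>\<rightarrow> (A \<^bold>\<and> B))"
| A7: "iK+bem \<turnstile> (A \<^bold>\<and> B) \<^bold>\<rightarrow> A"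
| A8: "iK+bem \<turnstile> (A \<^bold>\<and> B) \<^bold>\<rightarrow> B"
| A9: "iK+bem \<turnstile> \<^bold>\<bottom> \<^bold>\<rightarrow> A"
| K: "iK+bem \<turnstile> \<^bold>\<box> (\<phi> \<^bold>\<rightarrow> \<psi>) \<^bold>\<rightarrow> (\<^bold>\<box> \<phi> \<^bold>\<rightarrow> \<^bold>\<box> \<psi>)"
| bem: "iK+bem \<turnstile> \<^bold>\<box> \<phi> \<^bold>\<or> \<^bold>\<not> (\<^bold>\<box> \<phi>)"
| MP: "iK+bem \<turnstile> \<phi> \<Longrightarrow> iK+bem \<turnstile> \<phi> \<^bold>\<rightarrow> \<psi> \<Longrightarrow> iK+bem \<turnstile> \<psi>"
| Nec: "iK+bem \<turnstile> \<phi> \<Longrightarrow> iK+bem \<turnstile> \<^bold>\<box> \<phi>"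

definition birelational_model ::
    "'w set \<Rightarrow> 'w rel \<Rightarrow> 'w rel \<Rightarrow> ('w \<Rightarrow> 'p set) \<Rightarrow> bool" where
  "birelational_model W le R V \<longleftrightarrow>
     W \<noteq> {} \<and>
     partial_order_on W le \<and>
     R \<subseteq> W \<times> W \<and>
     (\<forall>x y z. (x, y) \<in> le \<and> (y, z) \<in> R \<longrightarrow> (x, z) \<in> R) \<and>
     (\<forall>x y. (x, y) \<in> le \<longrightarrow> V x \<subseteq> V y)"

definition BEM :: "'w rel \<Rightarrow> 'w rel \<Rightarrow> bool" where
  "BEM le R \<longleftrightarrow> (\<forall>x y z. (x, y) \<in> le \<and> (x, z) \<in> R \<longrightarrow> (y, z) \<in> R)"

text \<open>
  The carrier need not be mentioned: in a birelational model both relations are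
  contained in \<open>W \<times> W\<close>.
\<close>
primrec forces :: "'w rel \<Rightarrow> 'w rel \<Rightarrow> ('w \<Rightarrow> 'p set) \<Rightarrow> 'w \<Rightarrow> 'p fm \<Rightarrow> bool" where
  "forces le R V x (Var p) \<longleftrightarrow> p \<in> V x"
| "forces le R V x \<^bold>\<bottom> \<longleftrightarrow> False"
| "forces le R V x (\<phi> \<^bold>\<and> \<psi>) \<longleftrightarrow> forces le R V x \<phi> \<and> forces le R V x \<psi>"
| "forces le R V x (\<phi> \<^bold>\<or> \<psi>) \<longleftrightarrow> forces le R V x \<phi> \<or> forces le R V x \<psi>"
| "forces le R V x (\<phi> \<^bold>\<rightarrow> \<psi>) \<longleftrightarrow>
     (\<forall>y. (x, y) \<in> le \<longrightarrow> forces le R V y \<phi> \<longrightarrow> forces le R V y \<psi>)"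
| "forces le R V x (\<^bold>\<box> \<phi>) \<longleftrightarrow> (\<forall>y. (x, y) \<in> R \<longrightarrow> forces le R V y \<phi>)"

text \<open>
  HOL cannot quantify over types inside a formula, so validity is relative to a type
  supplying the worlds; the models range over all nonempty carriers within that type.
  Validity over all models implies validity at each such type. So a completeness theorem
  that assumes validity only at one type, such as the type of sets of formulas, implies
  completeness for the class of all models.
\<close>
definition BM_BEM_valid :: "'w itself \<Rightarrow> 'p fm \<Rightarrow> bool" where
  "BM_BEM_valid (_ :: 'w itself) \<phi> \<longleftrightarrow>
     (\<forall>(W :: 'w set) le R V.
        birelational_model W le R V \<and> BEM le R \<longrightarrow> (\<forall>x\<in>W. forces le R V x \<phi>))"

end

theory Submission
  imports Defs
begin

text \<open>
  Completeness via the canonical model: worlds are the prime theories ordered by inclusion, and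
  \<open>x\<close> sees \<open>z\<close> iff \<open>z\<close> contains every \<open>A\<close> with \<open>\<^bold>\<box> A \<in> x\<close>. Since a prime theory decides every boxed
  formula, prime theories related by inclusion contain the same boxed formulas, hence see the same
  worlds; this is BEM.
\<close>

text \<open>Necessitation enters only through theorems of the logic and is never applied to
  hypotheses. This is what makes the deduction theorem hold.\<close>

inductive derives :: "'p fm set \<Rightarrow> 'p fm \<Rightarrow> bool" (infix "\<tturnstile>" 50) for G where
  hyp: "A \<in> G \<Longrightarrow> G \<tturnstile> A"
| theorem_of_logic: "iK+bem \<turnstile> A \<Longrightarrow> G \<tturnstile> A"
| mp: "G \<tturnstile> A \<Longrightarrow> G \<tturnstile> A \<^bold>\<rightarrow> B \<Longrightarrow> G \<tturnstile> B"

lemma derives_empty: "{} \<tturnstile> A \<Longrightarrow> iK+bem \<turnstile> A"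
  by (induction rule: derives.induct) (simp, assumption, rule MP)

lemma derives_mono: "G \<tturnstile> A \<Longrightarrow> G \<subseteq> H \<Longrightarrow> H \<tturnstile> A"
  by (induction rule: derives.induct)
    (blast intro: derives.hyp derives.theorem_of_logic derives.mp)+

lemma derives_mp_thm: "iK+bem \<turnstile> A \<^bold>\<rightarrow> B \<Longrightarrow> G \<tturnstile> A \<Longrightarrow> G \<tturnstile> B"
  by (rule derives.mp[OF _ derives.theorem_of_logic])

lemma iK_bem_refl: "iK+bem \<turnstile> A \<^bold>\<rightarrow> A"
  using MP[OF A1 MP[OF A1 A2]] .

lemma deduction:
  assumes "insert A G \<tturnstile> B"
  shows "G \<tturnstile> A \<^bold>\<rightarrow> B"
  using assms
proof (induction rule: derives.induct)
  case (hyp B)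
  then show ?case
    by (auto intro: derives.theorem_of_logic iK_bem_refl derives_mp_thm[OF A1] derives.hyp)
next
  case (theorem_of_logic B)
  then show ?case
    using derives.theorem_of_logic[OF MP[OF _ A1]] by blast
next
  case (mp B C)
  show ?case
    using derives.mp[OF mp.IH(2) derives_mp_thm[OF A2 mp.IH(1)]] .
qed

lemma derives_Or_elim:
  assumes "G \<tturnstile> A \<^bold>\<or> B" "insert A G \<tturnstile> C" "insert B G \<tturnstile> C"
  shows "G \<tturnstile> C"
  using derives.mp[OF deduction[OF assms(3)]
      derives.mp[OF deduction[OF assms(2)] derives_mp_thm[OF A5 assms(1)]]] .

text \<open>Box every line of the derivation: hypotheses become members of \<open>G\<close>,
  theorems stay theorems by necessitation, and \<open>K\<close> carries modus ponens
  through.\<close>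

lemma derives_Box:
  assumes "{B. \<^bold>\<box> B \<in> G} \<tturnstile> A"
  shows "G \<tturnstile> \<^bold>\<box> A"
  using assms
proof (induction rule: derives.induct)
  case (mp A B)
  show ?case
    using derives.mp[OF mp.IH(1) derives_mp_thm[OF K mp.IH(2)]] .
qed (auto intro: derives.hyp derives.theorem_of_logic Nec)

text \<open>In the modus ponens case the premises may come from two different members of the chain;
  the larger of the two derives both.\<close>

lemma derives_Union_chain:
  assumes "\<Union>C \<tturnstile> A" "C \<noteq> {}" "subset.chain S C"
  shows "\<exists>G\<in>C. G \<tturnstile> A"
  using assms(1)
proof (induction rule: derives.induct)
  case (mp A B)
  then obtain G H where GH: "G \<in> C" "H \<in> C" "G \<tturnstile> A" "H \<tturnstile> A \<^bold>\<rightarrow> B" by blast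
  then have "G \<subseteq> H \<or> H \<subseteq> G"
    using assms(3) by (auto simp: subset_chain_def)
  then show ?case
    using GH by (meson derives.mp derives_mono)
qed (use assms(2) in \<open>auto intro: derives.hyp derives.theorem_of_logic\<close>)

definition prime_theory :: "'p fm set \<Rightarrow> bool" where
  "prime_theory x \<longleftrightarrow>
     (\<forall>A. x \<tturnstile> A \<longrightarrow> A \<in> x) \<and> \<^bold>\<bottom> \<notin> x \<and> (\<forall>A B. A \<^bold>\<or> B \<in> x \<longrightarrow> A \<in> x \<or> B \<in> x)"

lemma prime_theory_derives: "prime_theory x \<Longrightarrow> x \<tturnstile> A \<longleftrightarrow> A \<in> x"
  by (auto simp: prime_theory_def intro: derives.hyp)

lemma prime_theory_mp: "prime_theory x \<Longrightarrow> A \<^bold>\<rightarrow> B \<in> x \<Longrightarrow> A \<in> x \<Longrightarrow> B \<in> x"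
  by (metis derives.mp prime_theory_derives)

lemma prime_theory_And: "prime_theory x \<Longrightarrow> A \<^bold>\<and> B \<in> x \<longleftrightarrow> A \<in> x \<and> B \<in> x"
  by (metis A6 A7 A8 derives.theorem_of_logic prime_theory_derives prime_theory_mp)

lemma prime_theory_Or: "prime_theory x \<Longrightarrow> A \<^bold>\<or> B \<in> x \<longleftrightarrow> A \<in> x \<or> B \<in> x"
  by (metis A3 A4 derives_mp_thm prime_theory_def prime_theory_derives)

text \<open>Lindenbaum's lemma: by Zorn there is a maximal extension of \<open>G\<close> that does
  not derive \<open>A\<close>, and maximality forces it to be prime.\<close>

lemma prime_extension:
  assumes "\<not> G \<tturnstile> A"
  obtains x where "prime_theory x" "G \<subseteq> x" "A \<notin> x"
proof -
  let ?S = "{H. G \<subseteq> H \<and> \<not> H \<tturnstile> A}"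
  have "\<exists>M\<in>?S. \<forall>X\<in>?S. M \<subseteq> X \<longrightarrow> X = M"
  proof (rule subset_Zorn_nonempty)
    show "?S \<noteq> {}" using assms by blast
  next
    fix C assume C: "C \<noteq> {}" "subset.chain ?S C"
    then have sub: "C \<subseteq> ?S" by (simp add: subset_chain_def)
    then have "\<not> \<Union>C \<tturnstile> A" using derives_Union_chain[OF _ C] by auto
    moreover have "G \<subseteq> \<Union>C" using sub C(1) by blast
    ultimately show "\<Union>C \<in> ?S" by blast
  qed
  then obtain M where M: "G \<subseteq> M" "\<not> M \<tturnstile> A"
    and max: "\<And>X. M \<subseteq> X \<Longrightarrow> \<not> X \<tturnstile> A \<Longrightarrow> X = M"
    by (metis (no_types, lifting) mem_Collect_eq subset_trans)
  \<comment> \<open>By maximality, any proper enlargement of \<open>M\<close> derives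
    \<open>A\<close>. Closure and the disjunction property then follow by contradiction, since a
    failure of either would let \<open>M\<close> itself derive \<open>A\<close>.\<close>
  have ins: "insert B M \<tturnstile> A" if "B \<notin> M" for B
    using max[OF subset_insertI] that by (metis insertI1)
  have closed: "B \<in> M" if "M \<tturnstile> B" for B
    using derives.mp[OF that deduction[OF ins]] M(2) by metis
  have "\<^bold>\<bottom> \<notin> M"
    using M(2) derives_mp_thm[OF A9 derives.hyp] by metis
  moreover have "B \<in> M \<or> C \<in> M" if "B \<^bold>\<or> C \<in> M" for B C
    using derives_Or_elim[OF derives.hyp[OF that] ins ins] M(2) by metis
  ultimately have "prime_theory M"
    using closed by (auto simp: prime_theory_def)
  moreover have "A \<notin> M" using M(2) derives.hyp by metis
  ultimately show thesis using that M(1) by blast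
qed

lemma prime_theory_Imp:
  assumes "prime_theory x"
  shows "A \<^bold>\<rightarrow> B \<in> x \<longleftrightarrow> (\<forall>y. prime_theory y \<and> x \<subseteq> y \<longrightarrow> A \<in> y \<longrightarrow> B \<in> y)"
proof
  assume "A \<^bold>\<rightarrow> B \<in> x"
  then show "\<forall>y. prime_theory y \<and> x \<subseteq> y \<longrightarrow> A \<in> y \<longrightarrow> B \<in> y"
    using prime_theory_mp by blast
next
  assume *: "\<forall>y. prime_theory y \<and> x \<subseteq> y \<longrightarrow> A \<in> y \<longrightarrow> B \<in> y"
  have "insert A x \<tturnstile> B"
    using * by (metis insert_subset prime_extension)
  then show "A \<^bold>\<rightarrow> B \<in> x"
    using deduction prime_theory_derives[OF assms] by blast
qed

text \<open>From right to left: if the unboxed formulas of \<open>x\<close> did not derive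
  \<open>A\<close>, a prime extension of them would omit \<open>A\<close>. So they derive
  \<open>A\<close>, and boxing that derivation puts the box of \<open>A\<close> into
  \<open>x\<close>.\<close>

lemma prime_theory_Box:
  assumes "prime_theory x"
  shows "\<^bold>\<box> A \<in> x \<longleftrightarrow> (\<forall>y. prime_theory y \<and> {B. \<^bold>\<box> B \<in> x} \<subseteq> y \<longrightarrow> A \<in> y)"
proof
  assume *: "\<forall>y. prime_theory y \<and> {B. \<^bold>\<box> B \<in> x} \<subseteq> y \<longrightarrow> A \<in> y"
  have "{B. \<^bold>\<box> B \<in> x} \<tturnstile> A"
    using * by (metis prime_extension)
  then show "\<^bold>\<box> A \<in> x"
    using derives_Box prime_theory_derives[OF assms] by blast
qed blast

lemma prime_theory_same_boxes:
  assumes "prime_theory x" "prime_theory y" "x \<subseteq> y"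
  shows "\<^bold>\<box> A \<in> y \<longleftrightarrow> \<^bold>\<box> A \<in> x"
proof
  assume "\<^bold>\<box> A \<in> y"
  \<comment> \<open>The negation would pass from \<open>x\<close> up to \<open>y\<close> and yield
    falsum there.\<close>
  then have "\<^bold>\<not> (\<^bold>\<box> A) \<notin> x"
    using assms prime_theory_mp[OF assms(2)] by (auto simp: prime_theory_def)
  moreover have "\<^bold>\<box> A \<^bold>\<or> \<^bold>\<not> (\<^bold>\<box> A) \<in> x"
    using derives.theorem_of_logic[OF bem] prime_theory_derives[OF assms(1)] by blast
  ultimately show "\<^bold>\<box> A \<in> x"
    using prime_theory_Or[OF assms(1)] by blast
qed (use assms in blast)

text \<open>Since \<open>forces\<close> ignores the carrier, the restriction to prime theories is
  built into \<open>can_le\<close> and \<open>can_R\<close>.\<close>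

definition can_le :: "'p fm set rel" where
  "can_le = {(x, y). prime_theory x \<and> prime_theory y \<and> x \<subseteq> y}"

definition can_R :: "'p fm set rel" where
  "can_R = {(x, y). prime_theory x \<and> prime_theory y \<and> {B. \<^bold>\<box> B \<in> x} \<subseteq> y}"

definition can_V :: "'p fm set \<Rightarrow> 'p set" where
  "can_V x = {p. Var p \<in> x}"

lemma truth_lemma: "prime_theory x \<Longrightarrow> forces can_le can_R can_V x A \<longleftrightarrow> A \<in> x"
proof (induction A arbitrary: x)
  case (Imp A B)
  then show ?case
    by (auto simp: prime_theory_Imp can_le_def)
next
  case (Box A)
  then show ?case
    unfolding prime_theory_Box[OF Box.prems, of A] by (auto simp: can_R_def)
qed (auto simp: can_V_def prime_theory_And prime_theory_Or, auto simp: prime_theory_def)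

text \<open>The theory \<open>x\<close> witnesses that the carrier is nonempty. A smaller theory has
  fewer boxed formulas, so it sees every world that a larger one sees.\<close>

lemma canonical_model:
  assumes "prime_theory (x :: 'p fm set)"
  shows "birelational_model {y :: 'p fm set. prime_theory y} can_le can_R can_V"
  using assms
  unfolding birelational_model_def partial_order_on_def preorder_on_def
  by (auto simp: can_le_def can_R_def can_V_def refl_on_def trans_def antisym_def)

lemma canonical_BEM: "BEM (can_le :: 'p fm set rel) can_R"
  unfolding BEM_def
proof (intro allI impI)
  fix x y z :: "'p fm set"
  assume *: "(x, y) \<in> can_le \<and> (x, z) \<in> can_R"
  then have "{A. \<^bold>\<box> A \<in> y} = {A. \<^bold>\<box> A \<in> x}"
    using prime_theory_same_boxes[of x y] by (simp add: can_le_def)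
  then show "(y, z) \<in> can_R"
    using * by (simp add: can_le_def can_R_def)
qed

theorem theorem3p1p8:
  fixes \<phi> :: "'p fm"
  assumes "BM_BEM_valid TYPE('p fm set) \<phi>"
  shows "iK+bem \<turnstile> \<phi>"
proof (rule ccontr)
  assume "\<not> iK+bem \<turnstile> \<phi>"
  then have "\<not> {} \<tturnstile> \<phi>" using derives_empty by blast
  then obtain x where x: "prime_theory x" "\<phi> \<notin> x"
    by (rule prime_extension)
  \<comment> \<open>The canonical worlds are sets of formulas, so validity at the type
    \<open>'p fm set\<close> applies to this model.\<close>
  have "forces can_le can_R can_V x \<phi>"
    using assms canonical_model[OF x(1)] canonical_BEM x(1)
    unfolding BM_BEM_valid_def by (metis mem_Collect_eq)
  then show False using truth_lemma x by blast
qed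

end
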